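(* Let $\boldsymbol{u}_h(\cdot,t)=(\rho_h,(\rho u)_h,E_h)^T\in\boldsymbol{\Pi}_h$, differentiable in $t$, be a solution of the semi-discrete scheme: for all $j=1,\dots,N$ and all $\boldsymbol{v}=(\zeta,\psi,\delta)^T\in\boldsymbol{\Pi}_h$, $$\partial_t\int_{K_j}\boldsymbol{u}_h\cdot\boldsymbol{v}\,r^2\,dr=\mathcal{F}_j(\boldsymbol{u}_h,\boldsymbol{v})+s_j^{[2],\mathrm{wb}}(\boldsymbol{u}_h,\psi)+s_j^{[3],\mathrm{tec}}\Big(\boldsymbol{u}_h,\hat{\boldsymbol{f}}^*,\frac{\partial\rho_h}{\partial t},\Phi_h,\delta\Big),$$ with $\mathcal{F}_j$, $s_j^{[2],\mathrm{wb}}$, $s_j^{[3],\mathrm{tec}}$, $\hat{\boldsymbol{f}}^*$, $\Phi_h$ as defined in the context. Then for every $j=1,\dots,N$, $$\frac{\partial}{\partial t}\int_{K_j}\Big(E_h+\frac12\rho_h\Phi_h\Big)r^2\,dr+\left.\left(\hat{f}^{*,[3]}+\hat{f}^{*,[1]}\Phi_h+\frac{1}{8\pi G}\Big(\Phi_h\frac{\partial}{\partial t}\Big(\frac{\partial\Phi_h}{\partial r}\Big)-\frac{\partial\Phi_h}{\partial t}\frac{\partial\Phi_h}{\partial r}\Big)\right)r^2\right|_{r_{j-1/2}^+}^{r_{j+1/2}^-}=0.$$ Consequently, if the total energy flux at the outer boundary vanishes, i.e. if the expression in the large parentheses is zero at $r=R$, then the total energy $\int_\Omega(E_h+\frac12\rho_h\Phi_h)\,r^2\,dr$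 is constant in time.
   Context: Equations. $\partial_t\boldsymbol{u}+r^{-2}\partial_r(r^2\boldsymbol{f}(\boldsymbol{u}))=\boldsymbol{s}(\boldsymbol{u},\Phi)$ with $\boldsymbol{u}=(\rho,\rho u,E)^T$, $\boldsymbol{f}(\boldsymbol{u})=(\rho u,\rho u^2+p,(E+p)u)^T$, $\boldsymbol{s}=(0,\frac{2p}{r}-\rho\,\partial_r\Phi,-\rho u\,\partial_r\Phi)^T$, ideal equation of state $p=(\gamma-1)(E-\frac12\rho u^2)$ with constant $\gamma>1$, and Poisson equation $r^{-2}\partial_r(r^2\partial_r\Phi)=4\pi G\rho$ with constant $G>0$. Superscripts $[i]$ denote the $i$-th component of a vector. From a numerical state $\boldsymbol{u}_h$, $u_h=(\rho u)_h/\rho_h$ and $p_h=(\gamma-1)(E_h-\frac12\rho_hu_h^2)$. It is understood that all states at which velocity, pressure, sound speed $c=\sqrt{\gamma p/\rho}$ or fluxes are evaluated have positive density (and positive pressure where $c$ is used). Mesh and spaces. $\Omega=[0,R]$ is partitioned into cells $K_j=[r_{j-1/2},r_{j+1/2}]$, $j=1,\dots,N$, $r_{1/2}=0$, $r_{N+1/2}=R$. Fix $k\ge1$; $\mathcal{V}_h=\{v\in L^2(\Omega): v|_{K_j}\in P^k(K_j)\ \forall j\}$ ($P^k$: polynomials of degree at most $k$), $\boldsymbol{\Pi}_h=\mathcal{V}_h^3$. Left and right limits at $r_{j+1/2}$ are denoted by $\psi^-_{j+1/2}$, $\psi^+_{j+1/2}$; $g|_{r_{j-1/2}^+}^{r_{j+1/2}^-}=g^-_{j+1/2}-g^+_{j-1/2}$,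 where numerical fluxes take their (single) interface values. Gauss--Radau projection. For a function $u$, $Pu\in\mathcal{V}_h$ is defined on every cell by $\int_{K_j}Pu\,\psi\,dr=\int_{K_j}u\,\psi\,dr$ for all $\psi\in P^{k-1}(K_j)$ and $Pu(r_{j-1/2}^+)=u(r_{j-1/2}^+)$; it acts componentwise on vectors. Gravitational potential. For a density $\rho_h\in\mathcal{V}_h$, $\frac{\partial\Phi_h}{\partial r}(r)=\frac{4\pi G}{r^2}\int_0^r\rho_h\tau^2\,d\tau$ with $\frac{\partial\Phi_h}{\partial r}(0)=0$, and $\Phi_h(r)=\Phi_h(R)-\int_r^R\frac{\partial\Phi_h}{\partial r}\,dr$, where $\Phi_h(R)$ is a prescribed constant (all integrals exact). Lane--Emden function. With $n=1/(\gamma-1)$, $\theta_n$ solves $\xi^{-2}\partial_\xi(\xi^2\partial_\xi\theta)=-\theta^n$, $\theta(0)=1$, $\theta'(0)=0$. Equilibrium recovery. Given $\boldsymbol{u}_h$, let $\rho_0,p_0$ be the density and pressure of $\boldsymbol{u}_h$ at $r=0$, $\kappa_0=p_0/\rho_0^\gamma$, $\alpha=\sqrt{\frac{\gamma}{\gamma-1}\kappa_0\rho_0^{\gamma-2}/(4\pi G)}$, and $$\boldsymbol{u}^d(r)=\Big(\rho_0\,\theta_n(r/\alpha)^{1/(\gamma-1)},\;0,\;\tfrac{\kappa_0}{\gamma-1}\rho_0^\gamma\,\theta_n(r/\alpha)^{\gamma/(\gamma-1)}\Big)^T,$$ with density $\rho^d$ and pressure $p^d=\kappa_0(\rho^d)^\gamma$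 (assumed well defined on $[0,R]$). Set $\boldsymbol{u}_h^e=P\boldsymbol{u}^d$ (with density $\rho_h^e$ and pressure $p_h^e$ computed from $\boldsymbol{u}_h^e$), $\boldsymbol{u}_h^f=\boldsymbol{u}_h-\boldsymbol{u}_h^e$, $\frac{\partial\Phi_h^e}{\partial r}=\frac{4\pi G}{r^2}\int_0^r\rho_h^e\tau^2\,d\tau$. Numerical flux. $\hat{\boldsymbol{f}}^*_{j+1/2}=\hat{\boldsymbol{f}}(\boldsymbol{u}^{*,-}_{h,j+1/2},\boldsymbol{u}^{*,+}_{h,j+1/2})$, where $\boldsymbol{u}^{*,\pm}_{h,j+1/2}=\boldsymbol{u}^d(r_{j+1/2})+\boldsymbol{u}^{f,\pm}_{h,j+1/2}$ (exterior values at the domain boundary are supplied by boundary conditions). $\hat{\boldsymbol{f}}$ is the HLLC flux $$\hat{\boldsymbol{f}}(\boldsymbol{u}^-,\boldsymbol{u}^+)=\begin{cases}\boldsymbol{f}(\boldsymbol{u}^-)&0\le S^-,\\ \boldsymbol{f}(\boldsymbol{u}^-)+S^-(\boldsymbol{u}_*^--\boldsymbol{u}^-)&S^-\le0\le S^*,\\ \boldsymbol{f}(\boldsymbol{u}^+)+S^+(\boldsymbol{u}_*^+-\boldsymbol{u}^+)&S^*\le0\le S^+,\\ \boldsymbol{f}(\boldsymbol{u}^+)&0\ge S^+,\end{cases}$$ with $S^-=\min\{u^--c^-,u^+-c^+\}$, $S^+=\max\{u^-+c^-,u^++c^+\}$, $S^*=\frac{p^+-p^-+\rho^-u^-(S^--u^-)-\rho^+u^+(S^+-u^+)}{\rho^-(S^--u^-)-\rho^+(S^+-u^+)}$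 and $$\boldsymbol{u}_*^\pm=\rho^\pm\frac{S^\pm-u^\pm}{S^\pm-S^*}\Big(1,\;S^*,\;\tfrac{E^\pm}{\rho^\pm}+(S^*-u^\pm)\big(S^*+\tfrac{p^\pm}{\rho^\pm(S^\pm-u^\pm)}\big)\Big)^T.$$ Scheme operators. For $\boldsymbol{v}=(\zeta,\psi,\delta)^T$, $$\mathcal{F}_j(\boldsymbol{u}_h,\boldsymbol{v})=-r_{j+1/2}^2\hat{\boldsymbol{f}}^*_{j+1/2}\cdot\boldsymbol{v}^-_{j+1/2}+r_{j-1/2}^2\hat{\boldsymbol{f}}^*_{j-1/2}\cdot\boldsymbol{v}^+_{j-1/2}+\int_{K_j}\boldsymbol{f}(\boldsymbol{u}_h)\cdot(\partial_r\boldsymbol{v})\,r^2dr,$$ $$s_j^{[2],\mathrm{wb}}(\boldsymbol{u}_h,\psi)=\int_{K_j}\Big(\frac{2p_h}{r}-\rho_h\frac{\partial\Phi_h}{\partial r}\Big)\psi\,r^2dr+s_j^{[2],\mathrm{cor}},$$ $$s_j^{[2],\mathrm{cor}}=r_{j+1/2}^2p^d(r_{j+1/2})\psi^-_{j+1/2}-r_{j-1/2}^2p^d(r_{j-1/2})\psi^+_{j-1/2}-\int_{K_j}p_h^e(\partial_r\psi)r^2dr-\int_{K_j}\Big(\frac{2p_h^e}{r}-\rho_h^e\frac{\partial\Phi_h^e}{\partial r}\Big)\psi\,r^2dr,$$ and, for a function $q$ (standing for an approximation of $\partial_t\rho$) and a potential $\Phi$, $$s_j^{[3],\mathrm{tec}}(\boldsymbol{u}_h,\hat{\boldsymbol{f}}^*,q,\Phi,\delta)=-\left.\big(\hat{f}^{*,[1]}\,\Phi\,\delta\,r^2\big)\right|_{r_{j-1/2}^+}^{r_{j+1/2}^-}-\int_{K_j}q\,\Phi\,\delta\,r^2dr+\int_{K_j}(\rho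 u)_h\,\Phi\,\frac{\partial\delta}{\partial r}\,r^2dr.$$ *)

theory Defs
  imports "HOL-Analysis.Analysis" "HOL-Computational_Algebra.Polynomial"
begin

section \<open>Conserved variables, flux and HLLC flux\<close>

text \<open>A state is \<open>u = (\<rho>, \<rho>u, E)\<close>, i.e. \<open>u $ 2\<close> is the momentum.\<close>

definition velocity :: "real^3 \<Rightarrow> real" where
  "velocity u = u $ 2 / u $ 1"

definition pressure :: "real \<Rightarrow> real^3 \<Rightarrow> real" where
  "pressure \<gamma> u = (\<gamma> - 1) * (u $ 3 - 1/2 * u $ 1 * (velocity u)\<^sup>2)"

definition sound_speed :: "real \<Rightarrow> real^3 \<Rightarrow> real" where
  "sound_speed \<gamma> u = sqrt (\<gamma> * pressure \<gamma> u / u $ 1)"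

definition flux :: "real \<Rightarrow> real^3 \<Rightarrow> real^3" where
  "flux \<gamma> u = vector [u $ 2,
                      u $ 1 * (velocity u)\<^sup>2 + pressure \<gamma> u,
                      (u $ 3 + pressure \<gamma> u) * velocity u]"

definition hllc_Sm :: "real \<Rightarrow> real^3 \<Rightarrow> real^3 \<Rightarrow> real" where
  "hllc_Sm \<gamma> um up = min (velocity um - sound_speed \<gamma> um) (velocity up - sound_speed \<gamma> up)"

definition hllc_Sp :: "real \<Rightarrow> real^3 \<Rightarrow> real^3 \<Rightarrow> real" where
  "hllc_Sp \<gamma> um up = max (velocity um + sound_speed \<gamma> um) (velocity up + sound_speed \<gamma> up)"

definition hllc_Sstar :: "real \<Rightarrow> real^3 \<Rightarrow> real^3 \<Rightarrow> real" where
  "hllc_Sstar \<gamma> um up =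
     (let Sm = hllc_Sm \<gamma> um up; Sp = hllc_Sp \<gamma> um up in
      (pressure \<gamma> up - pressure \<gamma> um
         + um $ 1 * velocity um * (Sm - velocity um)
         - up $ 1 * velocity up * (Sp - velocity up))
      / (um $ 1 * (Sm - velocity um) - up $ 1 * (Sp - velocity up)))"

text \<open>The intermediate state behind a wave of speed \<open>S\<close>, for contact speed \<open>Sst\<close>.\<close>

definition hllc_mid :: "real \<Rightarrow> real \<Rightarrow> real \<Rightarrow> real^3 \<Rightarrow> real^3" where
  "hllc_mid \<gamma> S Sst u =
     (u $ 1 * ((S - velocity u) / (S - Sst))) *\<^sub>R
     vector [1, Sst,
             u $ 3 / u $ 1
               + (Sst - velocity u) * (Sst + pressure \<gamma> u / (u $ 1 * (S - velocity u)))]"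

definition hllc :: "real \<Rightarrow> real^3 \<Rightarrow> real^3 \<Rightarrow> real^3" where
  "hllc \<gamma> um up =
     (let Sm = hllc_Sm \<gamma> um up; Sp = hllc_Sp \<gamma> um up; Sst = hllc_Sstar \<gamma> um up in
      if 0 \<le> Sm then flux \<gamma> um
      else if 0 \<le> Sst then flux \<gamma> um + Sm *\<^sub>R (hllc_mid \<gamma> Sm Sst um - um)
      else if 0 \<le> Sp then flux \<gamma> up + Sp *\<^sub>R (hllc_mid \<gamma> Sp Sst up - up)
      else flux \<gamma> up)"

section \<open>Mesh, broken polynomial spaces, Gauss--Radau projection\<close>

text \<open>The node \<open>r\<^bsub>j+1/2\<^esub>\<close> is \<open>x j\<close>, so cell number \<open>j\<close> (with \<open>1 \<le> j \<le> N\<close>) is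
  \<open>[x (j - 1), x j]\<close>.\<close>

definition mesh :: "real \<Rightarrow> nat \<Rightarrow> (nat \<Rightarrow> real) \<Rightarrow> bool" where
  "mesh R N x \<longleftrightarrow> 1 \<le> N \<and> x 0 = 0 \<and> x N = R \<and> (\<forall>j\<in>{1..N}. x (j - 1) < x j)"

definition cell :: "(nat \<Rightarrow> real) \<Rightarrow> nat \<Rightarrow> real set" where
  "cell x j = {x (j - 1)..x j}"

text \<open>Elements of \<open>V\<^sub>h\<close> are classes of functions modulo null sets. They are represented by
  functions that are polynomial in the interior of every cell; the values at the nodes are
  irrelevant, since only integrals and one-sided limits of such functions are ever used.\<close>

definition Vh :: "(nat \<Rightarrow> real) \<Rightarrow> nat \<Rightarrow> nat \<Rightarrow> (real \<Rightarrow> real) set" where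
  "Vh x N k = {v. \<forall>j\<in>{1..N}. \<exists>p::real poly. degree p \<le> k \<and>
                    (\<forall>r\<in>{x (j - 1)<..<x j}. v r = poly p r)}"

definition Pih :: "(nat \<Rightarrow> real) \<Rightarrow> nat \<Rightarrow> nat \<Rightarrow> (real \<Rightarrow> real^3) set" where
  "Pih x N k = {v. \<forall>i. (\<lambda>r. v r $ i) \<in> Vh x N k}"

definition trm :: "(real \<Rightarrow> 'a::t2_space) \<Rightarrow> real \<Rightarrow> 'a" where
  "trm g r = Lim (at_left r) g"

definition trp :: "(real \<Rightarrow> 'a::t2_space) \<Rightarrow> real \<Rightarrow> 'a" where
  "trp g r = Lim (at_right r) g"

definition is_radau_proj ::
  "(nat \<Rightarrow> real) \<Rightarrow> nat \<Rightarrow> nat \<Rightarrow> (real \<Rightarrow> real) \<Rightarrow> (real \<Rightarrow> real) \<Rightarrow> bool" where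
  "is_radau_proj x N k f w \<longleftrightarrow> w \<in> Vh x N k \<and>
     (\<forall>j\<in>{1..N}.
        (\<forall>\<psi>::real poly. degree \<psi> \<le> k - 1 \<longrightarrow>
           integral (cell x j) (\<lambda>r. w r * poly \<psi> r) = integral (cell x j) (\<lambda>r. f r * poly \<psi> r)) \<and>
        trp w (x (j - 1)) = trp f (x (j - 1)))"

text \<open>The projection is unique as an element of \<open>V\<^sub>h\<close>, that is, up to the values at the nodes
  (and outside of the domain); the choice operator merely selects a representative.\<close>

definition radau_proj ::
  "(nat \<Rightarrow> real) \<Rightarrow> nat \<Rightarrow> nat \<Rightarrow> (real \<Rightarrow> real^3) \<Rightarrow> real \<Rightarrow> real^3" where
  "radau_proj x N k f r = (\<chi> i. (SOME w. is_radau_proj x N k (\<lambda>r. f r $ i) w) r)"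

section \<open>Gravitational potential\<close>

definition dPhi :: "real \<Rightarrow> (real \<Rightarrow> real) \<Rightarrow> real \<Rightarrow> real" where
  "dPhi G \<rho> r = (if r = 0 then 0
                 else 4 * pi * G / r\<^sup>2 * integral {0..r} (\<lambda>\<tau>. \<rho> \<tau> * \<tau>\<^sup>2))"

text \<open>\<open>PhiR\<close> is the prescribed value of the potential at \<open>R\<close>.\<close>

definition Phi :: "real \<Rightarrow> real \<Rightarrow> real \<Rightarrow> (real \<Rightarrow> real) \<Rightarrow> real \<Rightarrow> real" where
  "Phi G R PhiR \<rho> r = PhiR - integral {r..R} (dPhi G \<rho>)"

section \<open>Equilibrium recovery\<close>

text \<open>\<open>\<theta>\<close> solves the Lane--Emden equation of (real) index \<open>n\<close> on the interval \<open>S\<close> starting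
  at \<open>0\<close>; nonnegativity makes the power \<open>\<theta>\<^sup>n\<close> meaningful.\<close>

definition lane_emden :: "real \<Rightarrow> (real \<Rightarrow> real) \<Rightarrow> real set \<Rightarrow> bool" where
  "lane_emden n \<theta> S \<longleftrightarrow> \<theta> 0 = 1 \<and> (\<forall>\<xi>\<in>S. 0 \<le> \<theta> \<xi>) \<and>
     (\<exists>\<theta>'. \<theta>' 0 = 0 \<and>
        (\<forall>\<xi>\<in>S. (\<theta> has_real_derivative \<theta>' \<xi>) (at \<xi> within S)) \<and>
        (\<forall>\<xi>\<in>S - {0}. \<exists>D. ((\<lambda>s. s\<^sup>2 * \<theta>' s) has_real_derivative D) (at \<xi> within S) \<and>
                          D / \<xi>\<^sup>2 = - (\<theta> \<xi> powr n)))"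

definition rho0 :: "(real \<Rightarrow> real^3) \<Rightarrow> real" where
  "rho0 u = trp u 0 $ 1"

definition p0 :: "real \<Rightarrow> (real \<Rightarrow> real^3) \<Rightarrow> real" where
  "p0 \<gamma> u = pressure \<gamma> (trp u 0)"

definition kappa0 :: "real \<Rightarrow> (real \<Rightarrow> real^3) \<Rightarrow> real" where
  "kappa0 \<gamma> u = p0 \<gamma> u / rho0 u powr \<gamma>"

definition alpha :: "real \<Rightarrow> real \<Rightarrow> (real \<Rightarrow> real^3) \<Rightarrow> real" where
  "alpha \<gamma> G u = sqrt (\<gamma> / (\<gamma> - 1) * kappa0 \<gamma> u * rho0 u powr (\<gamma> - 2) / (4 * pi * G))"

definition u_d :: "real \<Rightarrow> real \<Rightarrow> (real \<Rightarrow> real) \<Rightarrow> (real \<Rightarrow> real^3) \<Rightarrow> real \<Rightarrow> real^3" where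
  "u_d \<gamma> G \<theta> u r =
     vector [rho0 u * \<theta> (r / alpha \<gamma> G u) powr (1 / (\<gamma> - 1)),
             0,
             kappa0 \<gamma> u / (\<gamma> - 1) * rho0 u powr \<gamma> * \<theta> (r / alpha \<gamma> G u) powr (\<gamma> / (\<gamma> - 1))]"

definition p_d :: "real \<Rightarrow> real \<Rightarrow> (real \<Rightarrow> real) \<Rightarrow> (real \<Rightarrow> real^3) \<Rightarrow> real \<Rightarrow> real" where
  "p_d \<gamma> G \<theta> u r = kappa0 \<gamma> u * (u_d \<gamma> G \<theta> u r $ 1) powr \<gamma>"

definition u_e :: "real \<Rightarrow> real \<Rightarrow> (nat \<Rightarrow> real) \<Rightarrow> nat \<Rightarrow> nat \<Rightarrow> (real \<Rightarrow> real) \<Rightarrow>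
    (real \<Rightarrow> real^3) \<Rightarrow> real \<Rightarrow> real^3" where
  "u_e \<gamma> G x N k \<theta> u = radau_proj x N k (u_d \<gamma> G \<theta> u)"

definition u_f :: "real \<Rightarrow> real \<Rightarrow> (nat \<Rightarrow> real) \<Rightarrow> nat \<Rightarrow> nat \<Rightarrow> (real \<Rightarrow> real) \<Rightarrow>
    (real \<Rightarrow> real^3) \<Rightarrow> real \<Rightarrow> real^3" where
  "u_f \<gamma> G x N k \<theta> u r = u r - u_e \<gamma> G x N k \<theta> u r"

section \<open>Numerical flux and scheme operators\<close>

text \<open>\<open>uL\<close> and \<open>uR\<close> are the exterior states at \<open>r = 0\<close> and \<open>r = R\<close> supplied by the boundary
  conditions.\<close>

definition ustar_m :: "real \<Rightarrow> real \<Rightarrow> (nat \<Rightarrow> real) \<Rightarrow> nat \<Rightarrow> nat \<Rightarrow> (real \<Rightarrow> real) \<Rightarrow> real^3 \<Rightarrow>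
    (real \<Rightarrow> real^3) \<Rightarrow> nat \<Rightarrow> real^3" where
  "ustar_m \<gamma> G x N k \<theta> uL u j =
     (if j = 0 then uL else u_d \<gamma> G \<theta> u (x j) + trm (u_f \<gamma> G x N k \<theta> u) (x j))"

definition ustar_p :: "real \<Rightarrow> real \<Rightarrow> (nat \<Rightarrow> real) \<Rightarrow> nat \<Rightarrow> nat \<Rightarrow> (real \<Rightarrow> real) \<Rightarrow> real^3 \<Rightarrow>
    (real \<Rightarrow> real^3) \<Rightarrow> nat \<Rightarrow> real^3" where
  "ustar_p \<gamma> G x N k \<theta> uR u j =
     (if j = N then uR else u_d \<gamma> G \<theta> u (x j) + trp (u_f \<gamma> G x N k \<theta> u) (x j))"

definition fstar :: "real \<Rightarrow> real \<Rightarrow> (nat \<Rightarrow> real) \<Rightarrow> nat \<Rightarrow> nat \<Rightarrow> (real \<Rightarrow> real) \<Rightarrow>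
    real^3 \<Rightarrow> real^3 \<Rightarrow> (real \<Rightarrow> real^3) \<Rightarrow> nat \<Rightarrow> real^3" where
  "fstar \<gamma> G x N k \<theta> uL uR u j =
     hllc \<gamma> (ustar_m \<gamma> G x N k \<theta> uL u j) (ustar_p \<gamma> G x N k \<theta> uR u j)"

text \<open>In the operators below, \<open>fs j\<close> is the numerical flux at the node \<open>x j\<close>.\<close>

definition F_op :: "real \<Rightarrow> (nat \<Rightarrow> real) \<Rightarrow> (nat \<Rightarrow> real^3) \<Rightarrow> (real \<Rightarrow> real^3) \<Rightarrow>
    nat \<Rightarrow> (real \<Rightarrow> real^3) \<Rightarrow> real" where
  "F_op \<gamma> x fs u j v =
     - (x j)\<^sup>2 * (fs j \<bullet> trm v (x j))
     + (x (j - 1))\<^sup>2 * (fs (j - 1) \<bullet> trp v (x (j - 1)))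
     + integral (cell x j) (\<lambda>r. (flux \<gamma> (u r) \<bullet> vector_derivative v (at r)) * r\<^sup>2)"

definition s2_cor :: "real \<Rightarrow> real \<Rightarrow> (nat \<Rightarrow> real) \<Rightarrow> nat \<Rightarrow> nat \<Rightarrow> (real \<Rightarrow> real) \<Rightarrow>
    (real \<Rightarrow> real^3) \<Rightarrow> nat \<Rightarrow> (real \<Rightarrow> real) \<Rightarrow> real" where
  "s2_cor \<gamma> G x N k \<theta> u j \<psi> =
     (let ue = u_e \<gamma> G x N k \<theta> u; pd = p_d \<gamma> G \<theta> u in
      (x j)\<^sup>2 * pd (x j) * trm \<psi> (x j)
      - (x (j - 1))\<^sup>2 * pd (x (j - 1)) * trp \<psi> (x (j - 1))
      - integral (cell x j) (\<lambda>r. pressure \<gamma> (ue r) * deriv \<psi> r * r\<^sup>2)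
      - integral (cell x j)
          (\<lambda>r. (2 * pressure \<gamma> (ue r) / r - ue r $ 1 * dPhi G (\<lambda>s. ue s $ 1) r) * \<psi> r * r\<^sup>2))"

definition s2_wb :: "real \<Rightarrow> real \<Rightarrow> (nat \<Rightarrow> real) \<Rightarrow> nat \<Rightarrow> nat \<Rightarrow> (real \<Rightarrow> real) \<Rightarrow>
    (real \<Rightarrow> real^3) \<Rightarrow> nat \<Rightarrow> (real \<Rightarrow> real) \<Rightarrow> real" where
  "s2_wb \<gamma> G x N k \<theta> u j \<psi> =
     integral (cell x j)
       (\<lambda>r. (2 * pressure \<gamma> (u r) / r - u r $ 1 * dPhi G (\<lambda>s. u s $ 1) r) * \<psi> r * r\<^sup>2)
     + s2_cor \<gamma> G x N k \<theta> u j \<psi>"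

definition s3_tec :: "(nat \<Rightarrow> real) \<Rightarrow> (real \<Rightarrow> real^3) \<Rightarrow> (nat \<Rightarrow> real^3) \<Rightarrow>
    (real \<Rightarrow> real) \<Rightarrow> (real \<Rightarrow> real) \<Rightarrow> nat \<Rightarrow> (real \<Rightarrow> real) \<Rightarrow> real" where
  "s3_tec x u fs q \<Phi> j \<delta> =
     - (fs j $ 1 * trm (\<lambda>r. \<Phi> r * \<delta> r * r\<^sup>2) (x j)
        - fs (j - 1) $ 1 * trp (\<lambda>r. \<Phi> r * \<delta> r * r\<^sup>2) (x (j - 1)))
     - integral (cell x j) (\<lambda>r. q r * \<Phi> r * \<delta> r * r\<^sup>2)
     + integral (cell x j) (\<lambda>r. u r $ 2 * \<Phi> r * deriv \<delta> r * r\<^sup>2)"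

text \<open>The standing well-definedness requirements at one instant: \<open>u\<^sup>d\<close> is defined on \<open>[0, R]\<close>,
  and every state whose velocity, pressure, sound speed or flux enters the scheme has positive
  density, and positive pressure where the sound speed is used. On the closed cells, the endpoint
  values of a piecewise polynomial are its one-sided limits.\<close>

definition pos_density :: "(nat \<Rightarrow> real) \<Rightarrow> nat \<Rightarrow> (real \<Rightarrow> real^3) \<Rightarrow> bool" where
  "pos_density x N w \<longleftrightarrow> (\<forall>j\<in>{1..N}.
     (\<forall>r\<in>{x (j - 1)<..<x j}. 0 < w r $ 1) \<and>
     0 < trp w (x (j - 1)) $ 1 \<and> 0 < trm w (x j) $ 1)"

definition well_defined_state :: "real \<Rightarrow> real \<Rightarrow> real \<Rightarrow> (nat \<Rightarrow> real) \<Rightarrow> nat \<Rightarrow> nat \<Rightarrow>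
    (real \<Rightarrow> real) \<Rightarrow> real^3 \<Rightarrow> real^3 \<Rightarrow> (real \<Rightarrow> real^3) \<Rightarrow> bool" where
  "well_defined_state \<gamma> G R x N k \<theta> uL uR u \<longleftrightarrow>
     pos_density x N u \<and> 0 < p0 \<gamma> u \<and>
     lane_emden (1 / (\<gamma> - 1)) \<theta> {0..R / alpha \<gamma> G u} \<and>
     pos_density x N (u_e \<gamma> G x N k \<theta> u) \<and>
     (\<forall>j\<in>{0..N}.
        0 < ustar_m \<gamma> G x N k \<theta> uL u j $ 1 \<and> 0 < pressure \<gamma> (ustar_m \<gamma> G x N k \<theta> uL u j) \<and>
        0 < ustar_p \<gamma> G x N k \<theta> uR u j $ 1 \<and> 0 < pressure \<gamma> (ustar_p \<gamma> G x N k \<theta> uR u j))"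

section \<open>Total energy\<close>

text \<open>Time ranges over an interval \<open>I\<close>, with one-sided derivatives at endpoints belonging to it.\<close>

definition ddt :: "real set \<Rightarrow> (real \<Rightarrow> real) \<Rightarrow> real \<Rightarrow> real" where
  "ddt I f t = vector_derivative f (at t within I)"

definition total_energy_density ::
  "real \<Rightarrow> real \<Rightarrow> real \<Rightarrow> (real \<Rightarrow> real^3) \<Rightarrow> real \<Rightarrow> real" where
  "total_energy_density G R PhiR u r =
     u r $ 3 + 1/2 * u r $ 1 * Phi G R PhiR (\<lambda>s. u s $ 1) r"

text \<open>\<open>fs\<close> is the numerical flux at the point \<open>r\<close> at time \<open>t\<close>. The potential, its gradient and
  their time derivatives are continuous in \<open>r\<close> and need no one-sided limits.\<close>

definition total_energy_flux :: "real \<Rightarrow> real \<Rightarrow> real \<Rightarrow> real set \<Rightarrow> (real \<Rightarrow> real \<Rightarrow> real^3) \<Rightarrow>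
    real \<Rightarrow> real^3 \<Rightarrow> real \<Rightarrow> real" where
  "total_energy_flux G R PhiR I u t fs r =
     (let \<Phi> = (\<lambda>s. Phi G R PhiR (\<lambda>y. u s y $ 1) r);
          d\<Phi> = (\<lambda>s. dPhi G (\<lambda>y. u s y $ 1) r) in
      fs $ 3 + fs $ 1 * \<Phi> t
      + 1 / (8 * pi * G) * (\<Phi> t * ddt I d\<Phi> t - ddt I \<Phi> t * d\<Phi> t))"

end

theory Submission
  imports Defs
begin

text \<open>
  Testing the scheme with the constant \<open>(0, 0, 1)\<close> leaves an equation for the fluid energy of a
  cell: its time derivative is minus the increment of \<open>(f\<^sub>3 + f\<^sub>1 \<Phi>) r\<^sup>2\<close> (with \<open>f\<close> the numerical
  flux) minus the integral of \<open>\<sigma> \<Phi> r\<^sup>2\<close>, where \<open>\<sigma>\<close> is the time derivative of the density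
  \<open>\<rho>\<close> (\<open>scheme_unit_energy_test\<close>). The gravitational energy of the cell has the time derivative
  \<open>1/2 \<integral> (\<sigma> \<Phi> + \<rho> \<Phi>\<^sub>t) r\<^sup>2\<close>, so that altogether \<open>1/2 \<integral> (\<rho> \<Phi>\<^sub>t - \<sigma> \<Phi>) r\<^sup>2\<close> has to be a boundary term.
  Since \<open>\<Phi>\<close> and \<open>\<Phi>\<^sub>t\<close> solve the radial Poisson equation exactly, with densities \<open>\<rho>\<close> and \<open>\<sigma>\<close>,
  this is Green's second identity on the cell (\<open>green_identity_cell\<close>), and the boundary term is the
  one in the total energy flux.

  The analytic work is to justify the time derivatives of \<open>\<Phi>\<close>, of its gradient and of the
  gravitational energy. A density in \<open>V\<^sub>h\<close> is a combination of finitely many fixed broken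
  polynomials whose coefficients are its values at interior points of the cells
  (\<open>Vh_nodal_basis\<close>). Hence all these quantities are affine or quadratic in finitely many
  differentiable functions of time (\<open>potential_time_derivatives\<close>).

  Each node has a single numerical flux, and the factor \<open>r\<^sup>2\<close> vanishes at the centre, so that
  summing the cell balances leaves the flux at \<open>R\<close> only; this gives conservation.
\<close>

section \<open>Broken polynomials and the nodal basis\<close>

lemma mesh_mono:
  assumes "mesh R N x" and "i \<le> l" and "l \<le> N"
  shows "x i \<le> x l"
proof -
  have "x i \<le> x (i + d)" if "i + d \<le> N" for d
    using that
  proof (induction d)
    case (Suc d)
    have "x (i + Suc d - 1) < x (i + Suc d)"
      using assms(1) Suc.prems unfolding mesh_def by (elim conjE bspec) auto
    then show ?case using Suc by simp
  qed simp
  from this[of "l - i"] show ?thesis using assms by simp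
qed

lemma mesh_cell:
  assumes "mesh R N x" and "j \<in> {1..N}"
  shows "0 \<le> x (j - 1)" "x (j - 1) < x j" "x j \<le> R"
  using assms mesh_mono[OF assms(1), of 0 "j - 1"] mesh_mono[OF assms(1), of j N]
  by (auto simp: mesh_def)

lemma Vh_cell_poly:
  assumes "v \<in> Vh x N k" and "j \<in> {1..N}"
  obtains p where "degree p \<le> k" and "\<And>r. r \<in> {x (j - 1)<..<x j} \<Longrightarrow> v r = poly p r"
  using assms unfolding Vh_def by blast

lemma Vh_sum:
  assumes "finite Z" and "\<And>z. z \<in> Z \<Longrightarrow> b z \<in> Vh x N k"
  shows "(\<lambda>r. \<Sum>z\<in>Z. c z * b z r) \<in> Vh x N k"
  unfolding Vh_def
proof (intro CollectI ballI)
  fix j assume j: "j \<in> {1..N}"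
  have "\<forall>z\<in>Z. \<exists>p. degree p \<le> k \<and> (\<forall>r\<in>{x (j - 1)<..<x j}. b z r = poly p r)"
    using assms(2) j unfolding Vh_def by blast
  then obtain p where p: "\<And>z. z \<in> Z \<Longrightarrow> degree (p z) \<le> k"
      "\<And>z r. z \<in> Z \<Longrightarrow> r \<in> {x (j - 1)<..<x j} \<Longrightarrow> b z r = poly (p z) r"
    by metis
  show "\<exists>q. degree q \<le> k \<and> (\<forall>r\<in>{x (j - 1)<..<x j}. (\<Sum>z\<in>Z. c z * b z r) = poly q r)"
    using p assms(1)
    by (intro exI[of _ "\<Sum>z\<in>Z. smult (c z) (p z)"])
      (auto simp: poly_sum intro!: degree_sum_le order_trans[OF degree_smult_le] sum.cong)
qed

text \<open>\<open>L z\<close> is the Lagrange polynomial that is \<open>1\<close> at \<open>z\<close> and \<open>0\<close> at the other points of \<open>Z\<close>.\<close>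

lemma lagrange_interpolation:
  fixes p :: "real poly"
  assumes Z: "finite Z" "card Z = k + 1" and p: "degree p \<le> k"
  defines "L \<equiv> (\<lambda>z. \<Prod>y\<in>Z - {z}. smult (1 / (z - y)) [:- y, 1:])"
  shows "p = (\<Sum>z\<in>Z. smult (poly p z) (L z))"
    and "\<And>z. z \<in> Z \<Longrightarrow> degree (L z) \<le> k"
proof -
  show deg: "degree (L z) \<le> k" if "z \<in> Z" for z
  proof -
    have "degree (L z) \<le> (\<Sum>y\<in>Z - {z}. degree (smult (1 / (z - y)) [:- y, 1:]))"
      unfolding L_def
      using degree_prod_sum_le[of "Z - {z}" "\<lambda>y. smult (1 / (z - y)) [:- y, 1:]"] Z
      by (simp only: o_def finite_Diff)
    also have "\<dots> \<le> (\<Sum>y\<in>Z - {z}. 1)"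
      by (intro sum_mono) (simp add: order_trans[OF degree_smult_le])
    also have "\<dots> = k" using Z that by simp
    finally show ?thesis .
  qed
  have at_z: "poly (L z) w = (if w = z then 1 else 0)" if "z \<in> Z" "w \<in> Z" for z w
    using Z that
    by (auto simp: L_def poly_prod diff_divide_distrib[symmetric] intro!: prod.neutral bexI[of _ w])
  have "degree (\<Sum>z\<in>Z. smult (poly p z) (L z)) \<le> k"
    using deg Z by (intro degree_sum_le) (auto intro!: order_trans[OF degree_smult_le])
  moreover have "poly p w = poly (\<Sum>z\<in>Z. smult (poly p z) (L z)) w" if "w \<in> Z" for w
  proof -
    have "poly (\<Sum>z\<in>Z. smult (poly p z) (L z)) w = (\<Sum>z\<in>Z. if w = z then poly p z else 0)"
      unfolding poly_sum using at_z that by (intro sum.cong) auto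
    then show ?thesis using Z(1) that by simp
  qed
  ultimately show "p = (\<Sum>z\<in>Z. smult (poly p z) (L z))"
    using p Z by (intro poly_eqI_degree[of Z]) auto
qed

text \<open>\<open>V\<^sub>h\<close> has a nodal basis: \<open>k + 1\<close> Lagrange points in the interior of every cell determine a
  broken polynomial away from the mesh nodes. The coefficients are point values at interior
  points, so a time-dependent element of \<open>V\<^sub>h\<close> that is pointwise differentiable in time is a
  finite sum of fixed functions with differentiable coefficients.\<close>

lemma Vh_nodal_basis:
  assumes mesh: "mesh R N x"
  obtains Z :: "real set" and b :: "real \<Rightarrow> real \<Rightarrow> real"
  where "finite Z"
    and "\<And>z. z \<in> Z \<Longrightarrow> \<exists>j\<in>{1..N}. z \<in> {x (j - 1)<..<x j}"
    and "\<And>z. z \<in> Z \<Longrightarrow> b z \<in> Vh x N k"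
    and "\<And>v j r. v \<in> Vh x N k \<Longrightarrow> j \<in> {1..N} \<Longrightarrow> r \<in> {x (j - 1)<..<x j} \<Longrightarrow>
           v r = (\<Sum>z\<in>Z. v z * b z r)"
proof -
  let ?C = "\<lambda>j. {x (j - 1)<..<x j}"
  have less: False if "i \<in> {1..N}" "j \<in> {1..N}" "i < j" "r \<in> ?C i" "r \<in> ?C j" for i j r
  proof -
    have "x i \<le> x (j - 1)" by (rule mesh_mono[OF mesh]) (use that in auto)
    then show False using that by simp
  qed
  have unique: "i = j" if "i \<in> {1..N}" "j \<in> {1..N}" "r \<in> ?C i" "r \<in> ?C j" for i j r
    using less that by (metis linorder_neqE_nat)
  have "\<exists>Y. Y \<subseteq> ?C j \<and> finite Y \<and> card Y = k + 1" if "j \<in> {1..N}" for j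
    using infinite_arbitrarily_large[of "?C j" "k + 1"] mesh_cell(2)[OF mesh that] by auto
  then obtain Y where Y: "\<And>j. j \<in> {1..N} \<Longrightarrow> Y j \<subseteq> ?C j"
      "\<And>j. j \<in> {1..N} \<Longrightarrow> finite (Y j)" "\<And>j. j \<in> {1..N} \<Longrightarrow> card (Y j) = k + 1"
    by metis
  define J where "J = (\<lambda>z. SOME j. j \<in> {1..N} \<and> z \<in> ?C j)"
  have J: "J z = j" if "j \<in> {1..N}" "z \<in> ?C j" for j z
    unfolding J_def by (rule some_equality) (use that unique in blast)+
  define L where "L = (\<lambda>z. \<Prod>y\<in>Y (J z) - {z}. smult (1 / (z - y)) [:- y, 1:])"
  define b where "b = (\<lambda>z r. if r \<in> ?C (J z) then poly (L z) r else 0)"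
  define Z where "Z = (\<Union>j\<in>{1..N}. Y j)"
  have fin: "finite Z" using Y by (auto simp: Z_def)
  have cell_of: "\<exists>j\<in>{1..N}. z \<in> ?C j" if "z \<in> Z" for z
    using that Y(1) unfolding Z_def by blast
  have L: "degree (L z) \<le> k" "\<And>p. degree p \<le> k \<Longrightarrow> p = (\<Sum>z\<in>Y j. smult (poly p z) (L z))"
    if j: "j \<in> {1..N}" and z: "z \<in> Y j" for j z
  proof -
    have Jz: "J z = j" if "z \<in> Y j" for z using J j Y(1) that by blast
    show "degree (L z) \<le> k"
      using lagrange_interpolation(2)[OF Y(2,3)[OF j], where p = 0] z Jz[OF z] by (simp add: L_def)
    show "p = (\<Sum>z\<in>Y j. smult (poly p z) (L z))" if "degree p \<le> k" for p
      using lagrange_interpolation(1)[OF Y(2,3)[OF j] that] Jz by (simp add: L_def)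
  qed
  show ?thesis
  proof (rule that[OF fin cell_of])
    show "b z \<in> Vh x N k" if z: "z \<in> Z" for z
      unfolding Vh_def
    proof (intro CollectI ballI)
      fix j assume j: "j \<in> {1..N}"
      obtain i where i: "i \<in> {1..N}" "z \<in> Y i" using z unfolding Z_def by blast
      have Ji: "J z = i" using J i Y(1) by blast
      show "\<exists>p. degree p \<le> k \<and> (\<forall>r\<in>?C j. b z r = poly p r)"
      proof (cases "i = j")
        case True
        then show ?thesis using L(1)[OF i] Ji by (intro exI[of _ "L z"]) (auto simp: b_def)
      next
        case False
        then show ?thesis using unique[OF i(1) j] Ji by (intro exI[of _ 0]) (force simp: b_def)
      qed
    qed
    show "v r = (\<Sum>z\<in>Z. v z * b z r)"
      if v: "v \<in> Vh x N k" and j: "j \<in> {1..N}" and r: "r \<in> ?C j" for v j r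
    proof -
      obtain p where p: "degree p \<le> k" "\<And>r. r \<in> ?C j \<Longrightarrow> v r = poly p r"
        using Vh_cell_poly[OF v j] by blast
      obtain z0 where z0: "z0 \<in> Y j" using Y(3)[OF j] by fastforce
      have "(\<Sum>z\<in>Z. v z * b z r) = (\<Sum>z\<in>Y j. v z * b z r)"
      proof (rule sum.mono_neutral_right[OF fin])
        show "Y j \<subseteq> Z" using j by (auto simp: Z_def)
        show "\<forall>z\<in>Z - Y j. v z * b z r = 0"
        proof
          fix z assume z: "z \<in> Z - Y j"
          then obtain i where i: "i \<in> {1..N}" "z \<in> Y i" unfolding Z_def by blast
          then have "i \<noteq> j" "J z = i" using z J Y(1) by blast+
          then have "r \<notin> ?C (J z)" using unique[OF i(1) j] r by blast
          then show "v z * b z r = 0" by (simp only: b_def if_False mult_zero_right)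
        qed
      qed
      also have "\<dots> = (\<Sum>z\<in>Y j. poly p z * poly (L z) r)"
      proof (rule sum.cong[OF refl])
        fix z assume z: "z \<in> Y j"
        then have "z \<in> ?C j" "J z = j" using J j Y(1) by blast+
        then show "v z * b z r = poly p z * poly (L z) r" using p(2) r by (simp add: b_def)
      qed
      also have "\<dots> = poly p r"
        by (subst (2) L(2)[OF j z0 p(1)]) (simp add: poly_sum)
      finally show ?thesis using p(2)[OF r] by simp
    qed
  qed
qed

section \<open>Integration over the mesh\<close>

text \<open>Every point of the domain is a mesh node or an interior point of a cell, so a property that
  holds in the interior of every cell holds almost everywhere.\<close>

lemma mesh_cover:
  assumes "mesh R N x" and "r \<in> {0..R}" and "r \<notin> x ` {0..N}"
  obtains j where "j \<in> {1..N}" and "r \<in> {x (j - 1)<..<x j}"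
proof -
  define j where "j = (LEAST j. r \<le> x j)"
  have N: "r \<le> x N" using assms by (simp add: mesh_def)
  have le: "r \<le> x j" unfolding j_def by (rule LeastI[of _ N]) (rule N)
  have jN: "j \<le> N" unfolding j_def by (rule Least_le) (rule N)
  have j0: "j \<noteq> 0" using le assms by (cases "r = 0") (force simp: mesh_def)+
  have "\<not> r \<le> x (j - 1)" using j0 not_less_Least[of "j - 1" "\<lambda>j. r \<le> x j"] by (simp add: j_def)
  moreover have "r \<noteq> x j" using assms(3) jN by auto
  ultimately show ?thesis using that[of j] j0 jN le by auto
qed

lemma integral_cell_cong:
  assumes "\<And>r. r \<in> {x (j - 1)<..<x j} \<Longrightarrow> f r = g r"
  shows "integral (cell x j) f = integral (cell x j) g"
    and "f integrable_on cell x j \<longleftrightarrow> g integrable_on cell x j"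
proof -
  show "integral (cell x j) f = integral (cell x j) g"
    by (rule integral_spike[of "{x (j - 1), x j}"]) (use assms in \<open>auto simp: cell_def\<close>)
  show "f integrable_on cell x j \<longleftrightarrow> g integrable_on cell x j"
    using integrable_spike_interior[of "x (j - 1)" "x j" f g]
      integrable_spike_interior[of "x (j - 1)" "x j" g f] assms
    by (auto simp: cell_def)
qed

lemma has_integral_mesh:
  fixes f :: "real \<Rightarrow> real"
  assumes mesh: "mesh R N x" and f: "\<And>j. j \<in> {1..N} \<Longrightarrow> f integrable_on cell x j"
  shows "(f has_integral (\<Sum>j\<in>{1..N}. integral (cell x j) f)) {0..R}"
proof -
  have "(f has_integral (\<Sum>j\<in>{1..n}. integral (cell x j) f)) {0..x n}" if "n \<le> N" for n
    using that
  proof (induction n)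
    case 0
    then show ?case using mesh has_integral_refl(2)[of f "0::real"] by (simp add: mesh_def)
  next
    case (Suc n)
    have "0 \<le> x n" "x n \<le> x (Suc n)"
      using mesh_cell[OF mesh, of "Suc n"] Suc.prems by auto
    moreover have "(f has_integral integral (cell x (Suc n)) f) {x n..x (Suc n)}"
      using f[of "Suc n"] Suc.prems by (simp add: integrable_integral cell_def)
    ultimately have "(f has_integral (\<Sum>j\<in>{1..n}. integral (cell x j) f)
        + integral (cell x (Suc n)) f) {0..x (Suc n)}"
      using Suc.IH Suc.prems by (intro has_integral_combine[of 0 "x n"]) auto
    then show ?case by simp
  qed
  from this[of N] show ?thesis using mesh by (simp add: mesh_def)
qed

lemma Vh_times_continuous_integrable_cell:
  assumes mesh: "mesh R N x" and v: "v \<in> Vh x N k" and g: "continuous_on {0..R} g"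
    and j: "j \<in> {1..N}"
  shows "(\<lambda>r. v r * g r) integrable_on cell x j"
proof -
  obtain p where p: "\<And>r. r \<in> {x (j - 1)<..<x j} \<Longrightarrow> v r = poly p r"
    using Vh_cell_poly[OF v j] by blast
  have "continuous_on {x (j - 1)..x j} g"
    using g mesh_cell[OF mesh j] by (auto intro: continuous_on_subset)
  then have "(\<lambda>r. poly p r * g r) integrable_on cell x j"
    unfolding cell_def by (intro integrable_continuous_real continuous_intros)
  then show ?thesis
    using integral_cell_cong(2)[of x j "\<lambda>r. v r * g r" "\<lambda>r. poly p r * g r"] p by simp
qed

lemma Vh_times_continuous_integrable:
  assumes mesh: "mesh R N x" and v: "v \<in> Vh x N k" and g: "continuous_on {0..R} g"
    and r: "r \<le> R"
  shows "(\<lambda>s. v s * g s) integrable_on {0..r}"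
proof -
  have "(\<lambda>s. v s * g s) integrable_on {0..R}"
    using has_integral_mesh[OF mesh] Vh_times_continuous_integrable_cell[OF assms(1-3)] by blast
  then show ?thesis using r by (auto intro: integrable_subinterval_real)
qed

section \<open>The gravitational potential of a broken polynomial density\<close>

text \<open>This is the integrated Poisson equation; it holds at \<open>r = 0\<close> as well, where both sides
  vanish.\<close>

lemma sq_times_dPhi: "r\<^sup>2 * dPhi G v r = 4 * pi * G * integral {0..r} (\<lambda>\<tau>. v \<tau> * \<tau>\<^sup>2)"
  by (simp add: dPhi_def)

text \<open>The density is bounded in the first cell, so the mass in a ball of small radius \<open>r\<close> is
  \<open>O(r\<^sup>3)\<close>. This compensates the singular factor \<open>1 / r\<^sup>2\<close> in the potential gradient.\<close>

lemma mass_cubic_bound: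
  assumes mesh: "mesh R N x" and v: "v \<in> Vh x N k"
  obtains C where "\<And>r. r \<in> {0..x 1} \<Longrightarrow> \<bar>integral {0..r} (\<lambda>\<tau>. v \<tau> * \<tau>\<^sup>2)\<bar> \<le> C * r\<^sup>2 * r"
proof -
  have one: "1 \<in> {1..N}" and x0: "x 0 = 0" using mesh by (auto simp: mesh_def)
  obtain p where p: "\<And>r. r \<in> {x (1 - 1)<..<x 1} \<Longrightarrow> v r = poly p r"
    using Vh_cell_poly[OF v one] by blast
  have "compact (poly p ` {0..x 1})"
    by (intro compact_continuous_image continuous_intros) auto
  then obtain C where C: "C > 0" "\<And>r. r \<in> {0..x 1} \<Longrightarrow> \<bar>poly p r\<bar> \<le> C"
    using compact_imp_bounded bounded_pos by (metis imageI real_norm_def)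
  show ?thesis
  proof (rule that)
    fix r assume r: "r \<in> {0..x 1}"
    have "(\<lambda>\<tau>. v \<tau> * \<tau>\<^sup>2) integrable_on {0..r}"
      using r mesh_cell(3)[OF mesh one]
      by (intro Vh_times_continuous_integrable[OF mesh v] continuous_intros) auto
    then have "((\<lambda>\<tau>. v \<tau> * \<tau>\<^sup>2) has_integral integral {0..r} (\<lambda>\<tau>. v \<tau> * \<tau>\<^sup>2)) {0..r}"
      by (rule integrable_integral)
    moreover have "norm (v \<tau> * \<tau>\<^sup>2) \<le> C * r\<^sup>2" if "\<tau> \<in> {0..r} - {0, r}" for \<tau>
    proof -
      have "\<bar>v \<tau>\<bar> \<le> C" using p[of \<tau>] C(2)[of \<tau>] that r x0 by auto
      moreover have "\<tau>\<^sup>2 \<le> r\<^sup>2" using that by (intro power_mono) auto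
      ultimately show ?thesis using C(1) by (simp add: abs_mult mult_mono)
    qed
    ultimately have "norm (integral {0..r} (\<lambda>\<tau>. v \<tau> * \<tau>\<^sup>2)) \<le> C * r\<^sup>2 * measure lborel {0..r}"
      using C(1) by (intro has_integral_bound_real[where S = "{0, r}"]) auto
    then show "\<bar>integral {0..r} (\<lambda>\<tau>. v \<tau> * \<tau>\<^sup>2)\<bar> \<le> C * r\<^sup>2 * r"
      using r by simp
  qed
qed

lemma mass_continuous:
  assumes mesh: "mesh R N x" and v: "v \<in> Vh x N k"
  shows "continuous_on {0..R} (\<lambda>r. integral {0..r} (\<lambda>\<tau>. v \<tau> * \<tau>\<^sup>2))"
  by (intro indefinite_integral_continuous_1 Vh_times_continuous_integrable[OF mesh v]
      continuous_intros) simp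

lemma mass_has_derivative:
  assumes mesh: "mesh R N x" and v: "v \<in> Vh x N k" and j: "j \<in> {1..N}"
    and r: "r \<in> {x (j - 1)<..<x j}"
  shows "((\<lambda>r. integral {0..r} (\<lambda>\<tau>. v \<tau> * \<tau>\<^sup>2)) has_real_derivative v r * r\<^sup>2) (at r)"
proof -
  obtain p where p: "\<And>r. r \<in> {x (j - 1)<..<x j} \<Longrightarrow> v r = poly p r"
    using Vh_cell_poly[OF v j] by blast
  have rR: "r \<in> {0<..<R}" using mesh_cell[OF mesh j] r by auto
  have at: "at r within {0..R} = at r"
    using rR by (intro at_within_interior) (simp add: interior_atLeastAtMost_real)
  have "isCont (\<lambda>\<tau>. v \<tau> * \<tau>\<^sup>2) r"
  proof -
    have "isCont (\<lambda>\<tau>. poly p \<tau> * \<tau>\<^sup>2) r" by (intro continuous_intros)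
    moreover have "\<forall>\<^sub>F \<tau> in nhds r. v \<tau> * \<tau>\<^sup>2 = poly p \<tau> * \<tau>\<^sup>2"
      using eventually_nhds_in_open[of "{x (j - 1)<..<x j}" r] r
      by (auto elim!: eventually_mono simp: p)
    ultimately show ?thesis
      using isCont_cong[of "\<lambda>\<tau>. v \<tau> * \<tau>\<^sup>2" "\<lambda>\<tau>. poly p \<tau> * \<tau>\<^sup>2" r] by simp
  qed
  moreover have "(\<lambda>\<tau>. v \<tau> * \<tau>\<^sup>2) integrable_on {0..R}"
    by (intro Vh_times_continuous_integrable[OF mesh v] continuous_intros) simp
  ultimately have "((\<lambda>u. integral {0..u} (\<lambda>\<tau>. v \<tau> * \<tau>\<^sup>2)) has_vector_derivative v r * r\<^sup>2)
      (at r within {0..R} - {})"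
    using rR at by (intro integral_has_vector_derivative_continuous_at) auto
  then show ?thesis by (simp add: has_real_derivative_iff_has_vector_derivative at)
qed

lemma dPhi_continuous:
  assumes mesh: "mesh R N x" and v: "v \<in> Vh x N k"
  shows "continuous_on {0..R} (dPhi G v)"
  unfolding continuous_on_eq_continuous_within
proof
  let ?M = "\<lambda>r. integral {0..r} (\<lambda>\<tau>. v \<tau> * \<tau>\<^sup>2)"
  fix r assume r: "r \<in> {0..R}"
  show "continuous (at r within {0..R}) (dPhi G v)"
  proof (cases "r = 0")
    case False
    have "continuous (at r within {0..R}) (\<lambda>r. 4 * pi * G / r\<^sup>2 * ?M r)"
      using mass_continuous[OF mesh v] r False
      by (intro continuous_intros) (auto simp: continuous_on_eq_continuous_within)
    then show ?thesis
      by (rule continuous_transform_within[where \<delta> = r])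
        (use r False in \<open>auto simp: dPhi_def dist_real_def\<close>)
  next
    case True
    have x1: "0 < x 1" using mesh_cell[OF mesh, of 1] mesh by (auto simp: mesh_def)
    obtain C where C: "\<And>r. r \<in> {0..x 1} \<Longrightarrow> \<bar>?M r\<bar> \<le> C * r\<^sup>2 * r"
      using mass_cubic_bound[OF mesh v] by blast
    have "norm (dPhi G v s) \<le> \<bar>4 * pi * G\<bar> * C * s" if s: "s \<in> {0<..x 1}" for s
    proof -
      have "\<bar>4 * pi * G\<bar> * \<bar>?M s\<bar> \<le> \<bar>4 * pi * G\<bar> * (C * s\<^sup>2 * s)"
        using C[of s] s by (intro mult_left_mono) auto
      then show ?thesis using s
        by (simp add: dPhi_def abs_mult divide_simps mult_ac power2_eq_square)
    qed
    moreover have "\<forall>\<^sub>F s in at 0 within {0..R}. s \<in> {0<..x 1}"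
      unfolding eventually_at using x1 by (intro exI[of _ "x 1"]) (auto simp: dist_real_def)
    ultimately have "\<forall>\<^sub>F s in at 0 within {0..R}. norm (dPhi G v s) \<le> \<bar>4 * pi * G\<bar> * C * s"
      by (rule eventually_mono[rotated])
    moreover have "((\<lambda>s. \<bar>4 * pi * G\<bar> * C * s) \<longlongrightarrow> 0) (at 0 within {0..R})"
      by (auto intro!: tendsto_eq_intros)
    ultimately have "(dPhi G v \<longlongrightarrow> 0) (at 0 within {0..R})"
      by (rule Lim_null_comparison)
    then show ?thesis using True by (simp add: continuous_within dPhi_def)
  qed
qed

lemma Phi_continuous:
  assumes mesh: "mesh R N x" and v: "v \<in> Vh x N k"
  shows "continuous_on {0..R} (Phi G R P v)"
  unfolding Phi_def
  by (intro continuous_intros indefinite_integral_continuous_1' integrable_continuous_real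
      dPhi_continuous[OF mesh v])

lemma Phi_has_derivative:
  assumes mesh: "mesh R N x" and v: "v \<in> Vh x N k" and r: "r \<in> {0<..<R}"
  shows "(Phi G R P v has_real_derivative dPhi G v r) (at r)"
proof -
  have int: "dPhi G v integrable_on {0..R}"
    by (intro integrable_continuous_real dPhi_continuous[OF mesh v])
  have at: "at r within {0..R} = at r"
    using r by (intro at_within_interior) (simp add: interior_atLeastAtMost_real)
  have "((\<lambda>s. integral {0..s} (dPhi G v)) has_vector_derivative dPhi G v r) (at r within {0..R})"
    using r by (intro integral_has_vector_derivative dPhi_continuous[OF mesh v]) auto
  then have "((\<lambda>s. P - integral {0..R} (dPhi G v) + integral {0..s} (dPhi G v))
      has_real_derivative dPhi G v r) (at r)"
    unfolding at has_real_derivative_iff_has_vector_derivative[symmetric]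
    by (auto intro!: derivative_eq_intros)
  then show ?thesis
  proof (rule DERIV_cong_ev[THEN iffD1, rotated -1])
    have "\<forall>\<^sub>F s in nhds r. s \<in> {0<..<R}"
      using r by (intro eventually_nhds_in_open) auto
    then show "\<forall>\<^sub>F s in nhds r. P - integral {0..R} (dPhi G v) + integral {0..s} (dPhi G v)
        = Phi G R P v s"
    proof eventually_elim
      case (elim s)
      then have "integral {0..s} (dPhi G v) + integral {s..R} (dPhi G v) = integral {0..R} (dPhi G v)"
        by (intro Henstock_Kurzweil_Integration.integral_combine int) auto
      then show ?case by (simp add: Phi_def)
    qed
  qed auto
qed

text \<open>Green's second identity for two radial Poisson equations: by \<open>sq_times_dPhi\<close> the function
  \<open>W\<close> is \<open>4 \<pi> G\<close> times a combination of potentials and masses. In its derivative the products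
  of the two gradients cancel, and the products of a density and a potential remain.\<close>

lemma green_identity_cell:
  fixes G R P Q :: real and x :: "nat \<Rightarrow> real" and \<rho> \<sigma> :: "real \<Rightarrow> real"
  assumes mesh: "mesh R N x" and \<rho>: "\<rho> \<in> Vh x N k" and \<sigma>: "\<sigma> \<in> Vh x N k" and j: "j \<in> {1..N}"
  defines "W \<equiv> (\<lambda>r. (Phi G R Q \<sigma> r * dPhi G \<rho> r - Phi G R P \<rho> r * dPhi G \<sigma> r) * r\<^sup>2)"
  shows "4 * pi * G * integral (cell x j) (\<lambda>r. (\<rho> r * Phi G R Q \<sigma> r - \<sigma> r * Phi G R P \<rho> r) * r\<^sup>2)
    = W (x j) - W (x (j - 1))"
proof -
  let ?M = "\<lambda>v r. integral {0..r} (\<lambda>\<tau>. v \<tau> * \<tau>\<^sup>2)"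
  have W: "W r = 4 * pi * G * (Phi G R Q \<sigma> r * ?M \<rho> r - Phi G R P \<rho> r * ?M \<sigma> r)" for r
    using sq_times_dPhi[of r G \<rho>] sq_times_dPhi[of r G \<sigma>] unfolding W_def by algebra
  note c = mesh_cell[OF mesh j]
  have "((\<lambda>r. 4 * pi * G * ((\<rho> r * Phi G R Q \<sigma> r - \<sigma> r * Phi G R P \<rho> r) * r\<^sup>2))
      has_integral W (x j) - W (x (j - 1))) {x (j - 1)..x j}"
  proof (rule fundamental_theorem_of_calculus_interior)
    have "continuous_on {0..R} W" unfolding W
      using mesh \<rho> \<sigma>
      by (intro continuous_intros Phi_continuous mass_continuous)
    then show "continuous_on {x (j - 1)..x j} W"
      using c by (auto intro: continuous_on_subset)
    fix r assume r: "r \<in> {x (j - 1)<..<x j}"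
    then have rR: "r \<in> {0<..<R}" using c by auto
    have "(W has_real_derivative 4 * pi * G *
        ((dPhi G \<sigma> r * ?M \<rho> r + \<rho> r * r\<^sup>2 * Phi G R Q \<sigma> r)
         - (dPhi G \<rho> r * ?M \<sigma> r + \<sigma> r * r\<^sup>2 * Phi G R P \<rho> r))) (at r)"
      unfolding W
      using mesh \<rho> \<sigma> rR j r
      by (intro DERIV_cmult DERIV_diff DERIV_mult Phi_has_derivative mass_has_derivative)
    moreover have "4 * pi * G * (dPhi G \<sigma> r * ?M \<rho> r) = 4 * pi * G * (dPhi G \<rho> r * ?M \<sigma> r)"
      using sq_times_dPhi[of r G \<rho>] sq_times_dPhi[of r G \<sigma>] by algebra
    ultimately show "(W has_vector_derivative
        4 * pi * G * ((\<rho> r * Phi G R Q \<sigma> r - \<sigma> r * Phi G R P \<rho> r) * r\<^sup>2)) (at r)"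
      unfolding has_real_derivative_iff_has_vector_derivative[symmetric]
      by (elim DERIV_cong) (simp add: algebra_simps)
  qed (use c in auto)
  then have "integral (cell x j) (\<lambda>r. 4 * pi * G * ((\<rho> r * Phi G R Q \<sigma> r - \<sigma> r * Phi G R P \<rho> r) * r\<^sup>2))
      = W (x j) - W (x (j - 1))"
    unfolding cell_def by (rule integral_unique)
  then show ?thesis by simp
qed

section \<open>Time derivatives\<close>

text \<open>The operators \<open>dPhi\<close>, \<open>Phi\<close> and the weighted cell integrals are linear (\<open>Phi\<close> is affine, with
  the constant \<open>P\<close> its value at \<open>R\<close>) and do not see the values of the density at the nodes.
  They are therefore determined by the nodal coefficients.\<close>

lemma dPhi_sum:
  assumes mesh: "mesh R N x" and Z: "finite Z" "\<And>z. z \<in> Z \<Longrightarrow> b z \<in> Vh x N k"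
    and v: "\<And>j r. j \<in> {1..N} \<Longrightarrow> r \<in> {x (j - 1)<..<x j} \<Longrightarrow> v r = (\<Sum>z\<in>Z. c z * b z r)"
    and r: "r \<in> {0..R}"
  shows "dPhi G v r = (\<Sum>z\<in>Z. c z * dPhi G (b z) r)"
proof -
  have int: "(\<lambda>\<tau>. b z \<tau> * \<tau>\<^sup>2) integrable_on {0..r}" if "z \<in> Z" for z
    using r by (intro Vh_times_continuous_integrable[OF mesh Z(2)[OF that]] continuous_intros) auto
  have "integral {0..r} (\<lambda>\<tau>. v \<tau> * \<tau>\<^sup>2) = integral {0..r} (\<lambda>\<tau>. \<Sum>z\<in>Z. c z * (b z \<tau> * \<tau>\<^sup>2))"
  proof (rule integral_spike[of "x ` {0..N}"])
    fix \<tau> assume \<tau>: "\<tau> \<in> {0..r} - x ` {0..N}"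
    then obtain j where "j \<in> {1..N}" "\<tau> \<in> {x (j - 1)<..<x j}"
      using mesh_cover[OF mesh, of \<tau>] r by auto
    from v[OF this] show "(\<Sum>z\<in>Z. c z * (b z \<tau> * \<tau>\<^sup>2)) = v \<tau> * \<tau>\<^sup>2"
      by (simp add: sum_distrib_right mult.assoc)
  qed (simp add: negligible_finite)
  also have "\<dots> = (\<Sum>z\<in>Z. c z * integral {0..r} (\<lambda>\<tau>. b z \<tau> * \<tau>\<^sup>2))"
    using int Z by (subst integral_sum) (auto intro: integrable_on_mult_right)
  finally show ?thesis by (simp add: dPhi_def sum_distrib_left mult_ac)
qed

lemma Phi_sum:
  assumes mesh: "mesh R N x" and Z: "finite Z" "\<And>z. z \<in> Z \<Longrightarrow> b z \<in> Vh x N k"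
    and v: "\<And>j r. j \<in> {1..N} \<Longrightarrow> r \<in> {x (j - 1)<..<x j} \<Longrightarrow> v r = (\<Sum>z\<in>Z. c z * b z r)"
    and r: "r \<in> {0..R}"
  shows "Phi G R P v r = P + (\<Sum>z\<in>Z. c z * Phi G R 0 (b z) r)"
proof -
  have int: "dPhi G (b z) integrable_on {r..R}" if "z \<in> Z" for z
    by (intro integrable_continuous_real continuous_on_subset[OF dPhi_continuous[OF mesh Z(2)[OF that]]])
      (use r in auto)
  have "integral {r..R} (dPhi G v) = integral {r..R} (\<lambda>s. \<Sum>z\<in>Z. c z * dPhi G (b z) s)"
    using r by (intro integral_cong dPhi_sum[OF mesh Z v]) auto
  also have "\<dots> = (\<Sum>z\<in>Z. c z * integral {r..R} (dPhi G (b z)))"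
    using int Z by (subst integral_sum) (auto intro: integrable_on_mult_right)
  finally show ?thesis by (simp add: Phi_def sum_negf)
qed

lemma integral_cell_sum:
  assumes mesh: "mesh R N x" and Z: "finite Z" "\<And>z. z \<in> Z \<Longrightarrow> b z \<in> Vh x N k"
    and j: "j \<in> {1..N}"
    and v: "\<And>r. r \<in> {x (j - 1)<..<x j} \<Longrightarrow> v r = (\<Sum>z\<in>Z. c z * b z r)"
    and g: "continuous_on {0..R} g"
  shows "integral (cell x j) (\<lambda>r. v r * g r) = (\<Sum>z\<in>Z. c z * integral (cell x j) (\<lambda>r. b z r * g r))"
proof -
  have "integral (cell x j) (\<lambda>r. v r * g r) = integral (cell x j) (\<lambda>r. \<Sum>z\<in>Z. c z * (b z r * g r))"
    by (rule integral_cell_cong(1)) (simp add: v sum_distrib_right mult.assoc)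
  also have "\<dots> = (\<Sum>z\<in>Z. c z * integral (cell x j) (\<lambda>r. b z r * g r))"
    using Vh_times_continuous_integrable_cell[OF mesh Z(2) g j] Z(1)
    by (subst integral_sum) (auto intro: integrable_on_mult_right)
  finally show ?thesis .
qed

lemma gravitational_energy_sum:
  assumes mesh: "mesh R N x" and Z: "finite Z" "\<And>z. z \<in> Z \<Longrightarrow> b z \<in> Vh x N k"
    and v: "\<And>j r. j \<in> {1..N} \<Longrightarrow> r \<in> {x (j - 1)<..<x j} \<Longrightarrow> v r = (\<Sum>z\<in>Z. c z * b z r)"
    and w: "\<And>j r. j \<in> {1..N} \<Longrightarrow> r \<in> {x (j - 1)<..<x j} \<Longrightarrow> w r = (\<Sum>z\<in>Z. d z * b z r)"
    and wV: "w \<in> Vh x N k" and j: "j \<in> {1..N}"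
  shows "integral (cell x j) (\<lambda>r. v r * (Phi G R P w r * r\<^sup>2))
    = (\<Sum>z\<in>Z. c z * (P * integral (cell x j) (\<lambda>r. b z r * r\<^sup>2)
        + (\<Sum>y\<in>Z. d y * integral (cell x j) (\<lambda>r. b z r * (Phi G R 0 (b y) r * r\<^sup>2)))))"
proof -
  have "integral (cell x j) (\<lambda>r. v r * (Phi G R P w r * r\<^sup>2))
    = (\<Sum>z\<in>Z. c z * integral (cell x j) (\<lambda>r. b z r * (Phi G R P w r * r\<^sup>2)))"
    by (intro integral_cell_sum[OF mesh Z j v[OF j]] continuous_intros Phi_continuous[OF mesh wV])
  also have "\<dots> = (\<Sum>z\<in>Z. c z * (P * integral (cell x j) (\<lambda>r. b z r * r\<^sup>2)
        + (\<Sum>y\<in>Z. d y * integral (cell x j) (\<lambda>r. b z r * (Phi G R 0 (b y) r * r\<^sup>2)))))"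
  proof (intro sum.cong refl arg_cong2[where f = "(*)"])
    fix z assume z: "z \<in> Z"
    have int: "(\<lambda>r. b z r * r\<^sup>2) integrable_on cell x j"
      "\<And>y. y \<in> Z \<Longrightarrow> (\<lambda>r. b z r * (Phi G R 0 (b y) r * r\<^sup>2)) integrable_on cell x j"
      using mesh Z z j
      by (auto intro!: Vh_times_continuous_integrable_cell continuous_intros Phi_continuous)
    have "integral (cell x j) (\<lambda>r. b z r * (Phi G R P w r * r\<^sup>2))
      = integral (cell x j) (\<lambda>r. P * (b z r * r\<^sup>2)
          + (\<Sum>y\<in>Z. d y * (b z r * (Phi G R 0 (b y) r * r\<^sup>2))))"
    proof (rule integral_cell_cong(1))
      fix r assume "r \<in> {x (j - 1)<..<x j}"
      then have "r \<in> {0..R}" using mesh_cell[OF mesh j] by auto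
      from Phi_sum[OF mesh Z w this] have
        "Phi G R P w r = P + (\<Sum>y\<in>Z. d y * Phi G R 0 (b y) r)" .
      then show "b z r * (Phi G R P w r * r\<^sup>2)
        = P * (b z r * r\<^sup>2) + (\<Sum>y\<in>Z. d y * (b z r * (Phi G R 0 (b y) r * r\<^sup>2)))"
        by (simp add: algebra_simps sum_distrib_left)
    qed
    also have "\<dots> = P * integral (cell x j) (\<lambda>r. b z r * r\<^sup>2)
        + (\<Sum>y\<in>Z. d y * integral (cell x j) (\<lambda>r. b z r * (Phi G R 0 (b y) r * r\<^sup>2)))"
      using int Z(1)
      by (simp add: integral_add integral_sum integrable_on_mult_right integrable_sum)
    finally show "integral (cell x j) (\<lambda>r. b z r * (Phi G R P w r * r\<^sup>2)) = \<dots>" .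
  qed
  finally show ?thesis .
qed

text \<open>The time derivative is only given point by point in the interior of the cells. That it is
  again a broken polynomial in \<open>r\<close> follows from differentiating the nodal expansion.\<close>

lemma Vh_time_derivative:
  assumes mesh: "mesh R N x" and I: "at t within I \<noteq> bot" "t \<in> I"
    and \<rho>: "\<And>s. s \<in> I \<Longrightarrow> \<rho> s \<in> Vh x N k"
    and \<sigma>: "\<And>j r. j \<in> {1..N} \<Longrightarrow> r \<in> {x (j - 1)<..<x j} \<Longrightarrow>
              ((\<lambda>s. \<rho> s r) has_real_derivative \<sigma> r) (at t within I)"
  shows "\<sigma> \<in> Vh x N k"
proof -
  obtain Z :: "real set" and b where Z: "finite Z"
      "\<And>z. z \<in> Z \<Longrightarrow> \<exists>j\<in>{1..N}. z \<in> {x (j - 1)<..<x j}"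
      "\<And>z. z \<in> Z \<Longrightarrow> b z \<in> Vh x N k"
      "\<And>v j r. v \<in> Vh x N k \<Longrightarrow> j \<in> {1..N} \<Longrightarrow> r \<in> {x (j - 1)<..<x j} \<Longrightarrow>
         v r = (\<Sum>z\<in>Z. v z * b z r)"
    using Vh_nodal_basis[OF mesh] by blast
  have eq: "\<sigma> r = (\<Sum>z\<in>Z. \<sigma> z * b z r)" if j: "j \<in> {1..N}" and r: "r \<in> {x (j - 1)<..<x j}" for j r
  proof -
    have "((\<lambda>s. \<Sum>z\<in>Z. \<rho> s z * b z r) has_real_derivative (\<Sum>z\<in>Z. \<sigma> z * b z r)) (at t within I)"
      using Z(2) \<sigma> by (intro DERIV_sum DERIV_cmult_right) blast
    then have "((\<lambda>s. \<rho> s r) has_real_derivative (\<Sum>z\<in>Z. \<sigma> z * b z r)) (at t within I)"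
      by (rule has_field_derivative_transform_within[OF _ zero_less_one I(2)])
        (use Z(4)[OF \<rho> j r] in auto)
    then show ?thesis
      using \<sigma>[OF j r] vector_derivative_unique_within[OF I(1)]
      unfolding has_real_derivative_iff_has_vector_derivative by blast
  qed
  have "(\<lambda>r. \<Sum>z\<in>Z. \<sigma> z * b z r) \<in> Vh x N k" by (rule Vh_sum[OF Z(1,3)])
  then show ?thesis unfolding Vh_def using eq by simp
qed

text \<open>Differentiation in time commutes with the gravitational operators, and the potential of
  \<open>\<sigma>\<close>, the time derivative of the density at time \<open>t\<close>, has boundary value \<open>0\<close> because the
  boundary value \<open>P\<close> does not depend on time. With the nodal expansions no differentiation
  under the integral sign is needed.\<close>

lemma potential_time_derivatives:
  assumes mesh: "mesh R N x" and I: "at t within I \<noteq> bot" "t \<in> I"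
    and \<rho>: "\<And>s. s \<in> I \<Longrightarrow> \<rho> s \<in> Vh x N k"
    and \<sigma>: "\<And>j r. j \<in> {1..N} \<Longrightarrow> r \<in> {x (j - 1)<..<x j} \<Longrightarrow>
              ((\<lambda>s. \<rho> s r) has_real_derivative \<sigma> r) (at t within I)"
  shows dPhi_time_derivative: "r \<in> {0..R} \<Longrightarrow>
          ((\<lambda>s. dPhi G (\<rho> s) r) has_real_derivative dPhi G \<sigma> r) (at t within I)"
    and Phi_time_derivative: "r \<in> {0..R} \<Longrightarrow>
          ((\<lambda>s. Phi G R P (\<rho> s) r) has_real_derivative Phi G R 0 \<sigma> r) (at t within I)"
    and gravitational_energy_time_derivative: "j \<in> {1..N} \<Longrightarrow>
          ((\<lambda>s. integral (cell x j) (\<lambda>r. \<rho> s r * (Phi G R P (\<rho> s) r * r\<^sup>2))) has_real_derivative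
            integral (cell x j) (\<lambda>r. \<sigma> r * (Phi G R P (\<rho> t) r * r\<^sup>2))
            + integral (cell x j) (\<lambda>r. \<rho> t r * (Phi G R 0 \<sigma> r * r\<^sup>2))) (at t within I)"
proof -
  have \<sigma>V: "\<sigma> \<in> Vh x N k" by (rule Vh_time_derivative[OF mesh I \<rho> \<sigma>])
  obtain Z :: "real set" and b where Z: "finite Z"
      "\<And>z. z \<in> Z \<Longrightarrow> \<exists>j\<in>{1..N}. z \<in> {x (j - 1)<..<x j}"
      "\<And>z. z \<in> Z \<Longrightarrow> b z \<in> Vh x N k"
      "\<And>v j r. v \<in> Vh x N k \<Longrightarrow> j \<in> {1..N} \<Longrightarrow> r \<in> {x (j - 1)<..<x j} \<Longrightarrow>
         v r = (\<Sum>z\<in>Z. v z * b z r)"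
    using Vh_nodal_basis[OF mesh] by blast
  have D: "((\<lambda>s. \<rho> s z) has_real_derivative \<sigma> z) (at t within I)" if "z \<in> Z" for z
    using Z(2)[OF that] \<sigma> by blast
  note transform = has_field_derivative_transform_within[OF _ zero_less_one I(2)]
  show "((\<lambda>s. dPhi G (\<rho> s) r) has_real_derivative dPhi G \<sigma> r) (at t within I)" if r: "r \<in> {0..R}"
  proof -
    have exp: "dPhi G v r = (\<Sum>z\<in>Z. v z * dPhi G (b z) r)" if "v \<in> Vh x N k" for v
      by (rule dPhi_sum[OF mesh Z(1,3) Z(4)[OF that] r])
    have "((\<lambda>s. \<Sum>z\<in>Z. \<rho> s z * dPhi G (b z) r) has_real_derivative dPhi G \<sigma> r) (at t within I)"
      unfolding exp[OF \<sigma>V] by (intro DERIV_sum DERIV_cmult_right D)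
    then show ?thesis by (rule transform) (use exp \<rho> in auto)
  qed
  show "((\<lambda>s. Phi G R P (\<rho> s) r) has_real_derivative Phi G R 0 \<sigma> r) (at t within I)"
    if r: "r \<in> {0..R}"
  proof -
    have exp: "Phi G R P v r = P + (\<Sum>z\<in>Z. v z * Phi G R 0 (b z) r)" if "v \<in> Vh x N k" for v P
      by (rule Phi_sum[OF mesh Z(1,3) Z(4)[OF that] r])
    have "((\<lambda>s. P + (\<Sum>z\<in>Z. \<rho> s z * Phi G R 0 (b z) r)) has_real_derivative Phi G R 0 \<sigma> r)
        (at t within I)"
      unfolding exp[OF \<sigma>V] by (intro DERIV_add DERIV_const DERIV_sum DERIV_cmult_right D)
    then show ?thesis by (rule transform) (use exp \<rho> in auto)
  qed
  assume j: "j \<in> {1..N}"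
  define A where "A z = integral (cell x j) (\<lambda>r. b z r * r\<^sup>2)" for z
  define B where "B z y = integral (cell x j) (\<lambda>r. b z r * (Phi G R 0 (b y) r * r\<^sup>2))" for z y
  have exp: "integral (cell x j) (\<lambda>r. v r * (Phi G R P w r * r\<^sup>2))
      = (\<Sum>z\<in>Z. v z * (P * A z + (\<Sum>y\<in>Z. w y * B z y)))"
    if "v \<in> Vh x N k" "w \<in> Vh x N k" for v w P
    unfolding A_def B_def
    by (rule gravitational_energy_sum[OF mesh Z(1,3) Z(4)[OF that(1)] Z(4)[OF that(2)] that(2) j])
  have "((\<lambda>s. \<Sum>z\<in>Z. \<rho> s z * (P * A z + (\<Sum>y\<in>Z. \<rho> s y * B z y))) has_real_derivative
      (\<Sum>z\<in>Z. \<sigma> z * (P * A z + (\<Sum>y\<in>Z. \<rho> t y * B z y))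
        + (0 + (\<Sum>y\<in>Z. \<sigma> y * B z y)) * \<rho> t z)) (at t within I)"
    by (intro DERIV_sum DERIV_mult DERIV_add DERIV_const DERIV_cmult_right D)
  also have "(\<Sum>z\<in>Z. \<sigma> z * (P * A z + (\<Sum>y\<in>Z. \<rho> t y * B z y)) + (0 + (\<Sum>y\<in>Z. \<sigma> y * B z y)) * \<rho> t z)
      = integral (cell x j) (\<lambda>r. \<sigma> r * (Phi G R P (\<rho> t) r * r\<^sup>2))
            + integral (cell x j) (\<lambda>r. \<rho> t r * (Phi G R 0 \<sigma> r * r\<^sup>2))"
    unfolding exp[OF \<sigma>V \<rho>[OF I(2)]] exp[OF \<rho>[OF I(2)] \<sigma>V]
    by (simp add: sum.distrib mult.commute)
  finally show "((\<lambda>s. integral (cell x j) (\<lambda>r. \<rho> s r * (Phi G R P (\<rho> s) r * r\<^sup>2))) has_real_derivative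
            integral (cell x j) (\<lambda>r. \<sigma> r * (Phi G R P (\<rho> t) r * r\<^sup>2))
            + integral (cell x j) (\<lambda>r. \<rho> t r * (Phi G R 0 \<sigma> r * r\<^sup>2))) (at t within I)"
    by (rule transform) (use exp \<rho> in auto)
qed

section \<open>The energy balance\<close>

lemma trm_eq:
  assumes "(g \<longlongrightarrow> l) (at_left (r::real))"
  shows "trm g r = l"
  unfolding trm_def using assms by (intro tendsto_Lim) auto

lemma trp_eq:
  assumes "(g \<longlongrightarrow> l) (at_right (r::real))"
  shows "trp g r = l"
  unfolding trp_def using assms by (intro tendsto_Lim) auto

lemma trm_const: "trm (\<lambda>_. w) r = w" and trp_const: "trp (\<lambda>_. w) r = w"
  by (intro trm_eq trp_eq tendsto_const)+

text \<open>Testing with \<open>(0, 0, 1)\<close> switches off the momentum source, its correction and all the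
  terms with a derivative of the test function. What is left of \<open>s3_tec\<close> is the gravitational
  energy flux and the cell integral of \<open>q \<Phi> r\<^sup>2\<close>.\<close>

lemma scheme_unit_energy_test:
  assumes mesh: "mesh R N x" and j: "j \<in> {1..N}"
    and \<Phi>: "continuous_on {0..R} \<Phi>"
  defines "v \<equiv> (\<lambda>r::real. axis 3 1 :: real^3)"
  shows "F_op \<gamma> x fs u j v + s2_wb \<gamma> G x N k \<theta> u j (\<lambda>r. v r $ 2)
           + s3_tec x u fs q \<Phi> j (\<lambda>r. v r $ 3)
    = - ((fs j $ 3 + fs j $ 1 * \<Phi> (x j)) * (x j)\<^sup>2
         - (fs (j - 1) $ 3 + fs (j - 1) $ 1 * \<Phi> (x (j - 1))) * (x (j - 1))\<^sup>2)
      - integral (cell x j) (\<lambda>r. q r * (\<Phi> r * r\<^sup>2))"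
proof -
  note c = mesh_cell[OF mesh j]
  have cont: "continuous_on {x (j - 1)..x j} (\<lambda>r. \<Phi> r * r\<^sup>2)"
    using c by (intro continuous_intros continuous_on_subset[OF \<Phi>]) auto
  have "((\<lambda>r. \<Phi> r * r\<^sup>2) \<longlongrightarrow> \<Phi> (x j) * (x j)\<^sup>2) (at (x j) within {x (j - 1)..x j})"
    using cont c unfolding continuous_on by force
  then have m: "trm (\<lambda>r. \<Phi> r * r\<^sup>2) (x j) = \<Phi> (x j) * (x j)\<^sup>2"
    using c by (intro trm_eq) (simp add: at_within_Icc_at_left)
  have "((\<lambda>r. \<Phi> r * r\<^sup>2) \<longlongrightarrow> \<Phi> (x (j - 1)) * (x (j - 1))\<^sup>2) (at (x (j - 1)) within {x (j - 1)..x j})"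
    using cont c unfolding continuous_on by force
  then have p: "trp (\<lambda>r. \<Phi> r * r\<^sup>2) (x (j - 1)) = \<Phi> (x (j - 1)) * (x (j - 1))\<^sup>2"
    using c by (intro trp_eq) (simp add: at_within_Icc_at_right)
  have v2: "(\<lambda>r. v r $ 2) = (\<lambda>r. 0)" and v3: "(\<lambda>r. v r $ 3) = (\<lambda>r. 1)"
    by (simp_all add: v_def axis_def)
  have "F_op \<gamma> x fs u j v = - (x j)\<^sup>2 * fs j $ 3 + (x (j - 1))\<^sup>2 * fs (j - 1) $ 3"
    by (simp add: F_op_def v_def trm_const trp_const inner_axis)
  moreover have "s2_wb \<gamma> G x N k \<theta> u j (\<lambda>r. v r $ 2) = 0"
    unfolding v2 by (simp add: s2_wb_def s2_cor_def Let_def trm_const trp_const)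
  moreover have "s3_tec x u fs q \<Phi> j (\<lambda>r. v r $ 3)
      = - (fs j $ 1 * (\<Phi> (x j) * (x j)\<^sup>2) - fs (j - 1) $ 1 * (\<Phi> (x (j - 1)) * (x (j - 1))\<^sup>2))
        - integral (cell x j) (\<lambda>r. q r * (\<Phi> r * r\<^sup>2))"
    unfolding v3 by (simp add: s3_tec_def m p[simplified] mult.assoc)
  ultimately show ?thesis by (simp add: algebra_simps)
qed

lemma component_time_derivative:
  fixes f :: "real \<Rightarrow> real^3"
  assumes "at t within I \<noteq> bot" and "f differentiable (at t within I)"
  shows "((\<lambda>s. f s $ i) has_real_derivative ddt I (\<lambda>s. f s $ i) t) (at t within I)"
proof -
  obtain f' where "(f has_vector_derivative f') (at t within I)"
    using assms(2) vector_derivative_works by blast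
  then have "((\<lambda>s. f s $ i) has_vector_derivative f' $ i) (at t within I)"
    by (rule bounded_linear.has_vector_derivative[OF bounded_linear_vec_nth])
  with vector_derivative_within[OF assms(1) this] show ?thesis
    by (simp add: ddt_def has_real_derivative_iff_has_vector_derivative)
qed

lemma ddt_eq:
  assumes "at t within I \<noteq> bot" and "(f has_real_derivative D) (at t within I)"
  shows "ddt I f t = D"
  using assms unfolding ddt_def has_real_derivative_iff_has_vector_derivative
  by (rule vector_derivative_within)

lemma interval_at_within_neq_bot:
  fixes I :: "real set"
  assumes "is_interval I" and "\<exists>a\<in>I. \<exists>b\<in>I. a < b" and "t \<in> I"
  shows "at t within I \<noteq> bot"
  using connected_imp_perfect[of I t] assms
  by (metis is_interval_connected_1 less_irrefl singletonD trivial_limit_within)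

lemma Vh_const: "(\<lambda>r. c) \<in> Vh x N k"
  unfolding Vh_def by (auto intro!: exI[of _ "[:c:]"])

theorem proposition3p3:
  fixes \<gamma> G R PhiR :: real
    and N k :: nat
    and x :: "nat \<Rightarrow> real"
    and \<theta> :: "real \<Rightarrow> real"
    and I :: "real set"
    and uL uR :: "real \<Rightarrow> real^3"
    and u :: "real \<Rightarrow> real \<Rightarrow> real^3"
    and fs :: "real \<Rightarrow> nat \<Rightarrow> real^3"
  assumes "\<gamma> > 1" and "G > 0" and "k \<ge> 1"
    and "mesh R N x"
    and "is_interval I" and "\<exists>a\<in>I. \<exists>b\<in>I. a < b"
    and "\<And>t. t \<in> I \<Longrightarrow> u t \<in> Pih x N k"
    and "\<And>t j r. t \<in> I \<Longrightarrow> j \<in> {1..N} \<Longrightarrow> r \<in> {x (j - 1)<..<x j} \<Longrightarrow>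
           (\<lambda>s. u s r) differentiable (at t within I)"
    and "\<And>t. t \<in> I \<Longrightarrow> well_defined_state \<gamma> G R x N k \<theta> (uL t) (uR t) (u t)"
    and "\<And>t j. fs t j = fstar \<gamma> G x N k \<theta> (uL t) (uR t) (u t) j"
    and "\<And>t j v. t \<in> I \<Longrightarrow> j \<in> {1..N} \<Longrightarrow> v \<in> Pih x N k \<Longrightarrow>
           ((\<lambda>s. integral (cell x j) (\<lambda>r. (u s r \<bullet> v r) * r\<^sup>2)) has_real_derivative
              F_op \<gamma> x (fs t) (u t) j v
              + s2_wb \<gamma> G x N k \<theta> (u t) j (\<lambda>r. v r $ 2)
              + s3_tec x (u t) (fs t)
                  (\<lambda>r. ddt I (\<lambda>s. u s r $ 1) t)
                  (Phi G R PhiR (\<lambda>r. u t r $ 1)) j (\<lambda>r. v r $ 3))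
             (at t within I)"
  shows "(\<forall>t\<in>I. \<forall>j\<in>{1..N}.
            ((\<lambda>s. integral (cell x j) (\<lambda>r. total_energy_density G R PhiR (u s) r * r\<^sup>2))
               has_real_derivative
               - (total_energy_flux G R PhiR I u t (fs t j) (x j) * (x j)\<^sup>2
                  - total_energy_flux G R PhiR I u t (fs t (j - 1)) (x (j - 1)) * (x (j - 1))\<^sup>2))
              (at t within I))
       \<and> ((\<forall>t\<in>I. total_energy_flux G R PhiR I u t (fs t N) R = 0) \<longrightarrow>
          (\<lambda>t. integral {0..R} (\<lambda>r. total_energy_density G R PhiR (u t) r * r\<^sup>2)) constant_on I)"
proof -
  note mesh = \<open>mesh R N x\<close> and scheme = assms(11)
  define \<rho> where "\<rho> = (\<lambda>s r. u s r $ 1)"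
  define \<sigma> where "\<sigma> = (\<lambda>t r. ddt I (\<lambda>s. u s r $ 1) t)"
  define En where "En = (\<lambda>s r. total_energy_density G R PhiR (u s) r * r\<^sup>2)"
  define TF where "TF = (\<lambda>t j. total_energy_flux G R PhiR I u t (fs t j) (x j) * (x j)\<^sup>2)"
  have bot: "at t within I \<noteq> bot" if "t \<in> I" for t
    using assms(5,6) that by (rule interval_at_within_neq_bot)
  have uV: "(\<lambda>r. u s r $ i) \<in> Vh x N k" if "s \<in> I" for s i
    using assms(7)[OF that] by (simp add: Pih_def)
  then have \<rho>V: "\<rho> s \<in> Vh x N k" if "s \<in> I" for s
    using that by (simp add: \<rho>_def)
  have \<sigma>: "((\<lambda>s. \<rho> s r) has_real_derivative \<sigma> t r) (at t within I)"
    if "t \<in> I" "j \<in> {1..N}" "r \<in> {x (j - 1)<..<x j}" for t j r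
    using component_time_derivative[OF bot assms(8)] that by (simp add: \<rho>_def \<sigma>_def)
  have \<sigma>V: "\<sigma> t \<in> Vh x N k" if "t \<in> I" for t
    by (rule Vh_time_derivative[OF mesh bot[OF that] that \<rho>V \<sigma>[OF that]])
  have int: "(\<lambda>r. u s r $ 3 * r\<^sup>2) integrable_on cell x j"
      "(\<lambda>r. \<rho> s r * (Phi G R PhiR (\<rho> s) r * r\<^sup>2)) integrable_on cell x j"
    if "s \<in> I" "j \<in> {1..N}" for s j
    using mesh uV \<rho>V that
    by (auto intro!: Vh_times_continuous_integrable_cell continuous_intros Phi_continuous)
  have En: "En s = (\<lambda>r. u s r $ 3 * r\<^sup>2 + 1/2 * (\<rho> s r * (Phi G R PhiR (\<rho> s) r * r\<^sup>2)))" for s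
    by (simp add: En_def total_energy_density_def \<rho>_def algebra_simps fun_eq_iff)
  have En_int: "En s integrable_on cell x j"
    "integral (cell x j) (En s) = integral (cell x j) (\<lambda>r. u s r $ 3 * r\<^sup>2)
      + 1/2 * integral (cell x j) (\<lambda>r. \<rho> s r * (Phi G R PhiR (\<rho> s) r * r\<^sup>2))"
    if "s \<in> I" "j \<in> {1..N}" for s j
    using int[OF that] unfolding En
    by (simp_all only: integrable_add integral_add integrable_on_mult_right integral_mult_right)

  have cell_balance: "((\<lambda>s. integral (cell x j) (En s)) has_real_derivative - (TF t j - TF t (j - 1)))
      (at t within I)" if t: "t \<in> I" and j: "j \<in> {1..N}" for t j
  proof -
    note td = mesh bot[OF t] t \<rho>V \<sigma>[OF t]
    let ?\<Phi> = "Phi G R PhiR (\<rho> t)" and ?\<Phi>t = "Phi G R 0 (\<sigma> t)"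
    let ?A = "integral (cell x j) (\<lambda>r. \<sigma> t r * (?\<Phi> r * r\<^sup>2))"
    let ?B = "integral (cell x j) (\<lambda>r. \<rho> t r * (?\<Phi>t r * r\<^sup>2))"
    \<comment> \<open>the fluid energy, from the test function \<open>(0, 0, 1)\<close>\<close>
    have "(\<lambda>r. axis 3 1) \<in> Pih x N k" using Vh_const by (simp add: Pih_def)
    from scheme[OF t j this] scheme_unit_energy_test[OF mesh j Phi_continuous[OF mesh \<rho>V[OF t]]]
    have E: "((\<lambda>s. integral (cell x j) (\<lambda>r. u s r $ 3 * r\<^sup>2)) has_real_derivative
       - ((fs t j $ 3 + fs t j $ 1 * ?\<Phi> (x j)) * (x j)\<^sup>2
         - (fs t (j - 1) $ 3 + fs t (j - 1) $ 1 * ?\<Phi> (x (j - 1))) * (x (j - 1))\<^sup>2) - ?A) (at t within I)"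
      by (simp add: inner_axis \<sigma>_def \<rho>_def)
    have "((\<lambda>s. integral (cell x j) (\<lambda>r. u s r $ 3 * r\<^sup>2)
        + 1/2 * integral (cell x j) (\<lambda>r. \<rho> s r * (Phi G R PhiR (\<rho> s) r * r\<^sup>2))) has_real_derivative
       - ((fs t j $ 3 + fs t j $ 1 * ?\<Phi> (x j)) * (x j)\<^sup>2
         - (fs t (j - 1) $ 3 + fs t (j - 1) $ 1 * ?\<Phi> (x (j - 1))) * (x (j - 1))\<^sup>2) - ?A
         + 1/2 * (?A + ?B)) (at t within I)"
      by (intro DERIV_add E DERIV_cmult gravitational_energy_time_derivative[OF td j])
    then have D: "((\<lambda>s. integral (cell x j) (En s)) has_real_derivative
       - ((fs t j $ 3 + fs t j $ 1 * ?\<Phi> (x j)) * (x j)\<^sup>2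
         - (fs t (j - 1) $ 3 + fs t (j - 1) $ 1 * ?\<Phi> (x (j - 1))) * (x (j - 1))\<^sup>2) - ?A
         + 1/2 * (?A + ?B)) (at t within I)"
      by (rule has_field_derivative_transform_within[OF _ zero_less_one t]) (simp add: En_int(2)[OF _ j])
    define W where "W r = (?\<Phi>t r * dPhi G (\<rho> t) r - ?\<Phi> r * dPhi G (\<sigma> t) r) * r\<^sup>2" for r
    have "?B - ?A = integral (cell x j) (\<lambda>r. (\<rho> t r * ?\<Phi>t r - \<sigma> t r * ?\<Phi> r) * r\<^sup>2)"
      using mesh \<rho>V[OF t] \<sigma>V[OF t] j
      by (subst integral_diff[symmetric])
        (auto simp: algebra_simps
          intro!: Vh_times_continuous_integrable_cell continuous_intros Phi_continuous)
    then have green: "4 * pi * G * (?B - ?A) = W (x j) - W (x (j - 1))"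
      using green_identity_cell[OF mesh \<rho>V[OF t] \<sigma>V[OF t] j, of G 0 PhiR] by (simp add: W_def)
    have TF: "TF t i = (fs t i $ 3 + fs t i $ 1 * ?\<Phi> (x i)) * (x i)\<^sup>2 - 1 / (8 * pi * G) * W (x i)"
      if "x i \<in> {0..R}" for i
    proof -
      have "ddt I (\<lambda>s. dPhi G (\<rho> s) (x i)) t = dPhi G (\<sigma> t) (x i)"
        by (rule ddt_eq[OF bot[OF t] dPhi_time_derivative[OF td that]])
      moreover have "ddt I (\<lambda>s. Phi G R PhiR (\<rho> s) (x i)) t = ?\<Phi>t (x i)"
        by (rule ddt_eq[OF bot[OF t] Phi_time_derivative[OF td that]])
      ultimately show ?thesis
        by (simp add: TF_def total_energy_flux_def Let_def W_def \<rho>_def algebra_simps)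
    qed
    have "?B - ?A = 1 / (4 * pi * G) * (W (x j) - W (x (j - 1)))"
      unfolding green[symmetric] using \<open>G > 0\<close> by simp
    then have "1/2 * (?B - ?A) = 1 / (8 * pi * G) * W (x j) - 1 / (8 * pi * G) * W (x (j - 1))"
      by (simp only:) (use \<open>G > 0\<close> in \<open>simp add: field_simps\<close>)
    moreover have "x j \<in> {0..R}" "x (j - 1) \<in> {0..R}" using mesh_cell[OF mesh j] by auto
    ultimately show ?thesis
      using D by (elim DERIV_cong) (simp add: TF)
  qed

  have "(\<lambda>t. integral {0..R} (En t)) constant_on I"
    if outer: "\<forall>t\<in>I. total_energy_flux G R PhiR I u t (fs t N) R = 0"
  proof -
    have N: "x N = R" "x 0 = 0" using mesh by (auto simp: mesh_def)
    have "((\<lambda>s. integral {0..R} (En s)) has_real_derivative 0) (at t within I)" if t: "t \<in> I" for t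
    proof -
      have "((\<lambda>s. \<Sum>j\<in>{1..N}. integral (cell x j) (En s)) has_real_derivative
          (\<Sum>j\<in>{1..N}. - (TF t j - TF t (j - 1)))) (at t within I)"
        by (intro DERIV_sum cell_balance[OF t])
      also have "(\<Sum>j\<in>{1..N}. - (TF t j - TF t (j - 1))) = - (TF t N - TF t 0)"
        using sum_telescope''[of 0 N "TF t"] by (simp only: sum_negf One_nat_def zero_le)
      \<comment> \<open>the centre contributes nothing, because \<open>x 0 = 0\<close>\<close>
      also have "\<dots> = 0" using outer t N by (simp add: TF_def)
      finally show ?thesis
        by (rule has_field_derivative_transform_within[OF _ zero_less_one t])
          (rule integral_unique[OF has_integral_mesh[OF mesh En_int(1)], symmetric])
    qed
    then show ?thesis
      using has_field_derivative_zero_constant[of I "\<lambda>s. integral {0..R} (En s)"] assms(5)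
      by (auto simp: is_interval_convex_1 constant_on_def)
  qed
  with cell_balance show ?thesis by (auto simp: En_def TF_def)
qed

end
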